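(* Let $0\le r\le3\times10^{-3}$ and $m\ge3$. Suppose that the points are generated in $\mathbb{R}^m$ according to any generative model consisting of five measures $\mu_p$, $p=1,\dots,5$, each supported in the ball $B((x^p,0,\dots,0),r)\subset\mathbb{R}^m$ of radius $r$ centered at $(x^p,0,\dots,0)$, where $$x^1=\Big(0,\tfrac{\sqrt3}{3},0\Big),\ x^2=\Big(\tfrac12,-\tfrac{\sqrt3}{6},0\Big),\ x^3=\Big(-\tfrac12,-\tfrac{\sqrt3}{6},0\Big),\ x^4=\Big(0,0,\tfrac12\Big),\ x^5=\Big(0,0,-\tfrac12\Big),$$ with $n'\ge1$ points drawn from each $\mu_p$ (so $n=5n'$ points in total). Then, almost surely, the linear program (LP2) for these points is not tight.
   Context: For points $y^1,\dots,y^n\in\mathbb{R}^m$, set $d_{ij}=\|y^i-y^j\|_2^2$ and $[n]=\{1,\dots,n\}$. (LP2) is the linear program in the entries of a symmetric matrix $X\in\mathbb{R}^{n\times n}$ ($X_{ij}=X_{ji}$): minimize $\sum_{i,j\in[n]}d_{ij}X_{ij}$ subject to $\mathrm{Tr}(X)=2$; $\sum_{j=1}^nX_{ij}=1$ for all $i\in[n]$; $X_{ij}+X_{ik}\le X_{ii}+X_{jk}$ for all pairwise distinct $i,j,k\in[n]$ with $j<k$; $X_{ij}\ge0$ for all $1\le i<j\le n$. A partition matrix (for two clusters) is a matrix of the form $\frac{1}{|\Gamma_1|}\mathbf{1}_{\Gamma_1}\mathbf{1}_{\Gamma_1}^T+\frac{1}{|\Gamma_2|}\mathbf{1}_{\Gamma_2}\mathbf{1}_{\Gamma_2}^T$,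 where $\Gamma_1,\Gamma_2$ are non-empty disjoint subsets of $[n]$ with union $[n]$ and $\mathbf{1}_\Gamma\in\mathbb{R}^n$ is the indicator vector of $\Gamma$. The LP is tight if its optimal solution is a partition matrix; it is not tight if no optimal solution of it is a partition matrix. *)

theory Defs
  imports "HOL-Probability.Probability"
begin

text \<open>
  The index set \<open>[n]\<close> is a finite linearly ordered type \<open>'n\<close>, and \<open>\<real>\<^sup>m\<close> is \<open>real ^ 'm\<close>,
  whose norm is the Euclidean one.
\<close>

definition sq_dist :: "('n \<Rightarrow> real ^ 'm) \<Rightarrow> 'n \<Rightarrow> 'n \<Rightarrow> real" where
  "sq_dist y i j = (norm (y i - y j))\<^sup>2"

definition LP2_feasible :: "real ^ ('n::{finite,linorder}) ^ ('n::{finite,linorder}) \<Rightarrow> bool" where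
  "LP2_feasible X \<longleftrightarrow>
     transpose X = X \<and>
     trace X = 2 \<and>
     (\<forall>i. (\<Sum>j\<in>UNIV. X $ i $ j) = 1) \<and>
     (\<forall>i j k. i \<noteq> j \<and> i \<noteq> k \<and> j < k \<longrightarrow> X $ i $ j + X $ i $ k \<le> X $ i $ i + X $ j $ k) \<and>
     (\<forall>i j. i < j \<longrightarrow> 0 \<le> X $ i $ j)"

definition LP2_objective :: "('n \<Rightarrow> real ^ 'm) \<Rightarrow> real ^ ('n::finite) ^ 'n \<Rightarrow> real" where
  "LP2_objective y X = (\<Sum>i\<in>UNIV. \<Sum>j\<in>UNIV. sq_dist y i j * X $ i $ j)"

definition LP2_optimal :: "('n \<Rightarrow> real ^ 'm) \<Rightarrow> real ^ ('n::{finite,linorder}) ^ ('n::{finite,linorder}) \<Rightarrow> bool" where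
  "LP2_optimal y X \<longleftrightarrow>
     LP2_feasible X \<and> (\<forall>Z. LP2_feasible Z \<longrightarrow> LP2_objective y X \<le> LP2_objective y Z)"

definition indicator_vec :: "'n set \<Rightarrow> real ^ ('n::finite)" where
  "indicator_vec \<Gamma> = (\<chi> i. indicator \<Gamma> i)"

definition cluster_matrix :: "'n set \<Rightarrow> real ^ ('n::finite) ^ 'n" where
  "cluster_matrix \<Gamma> =
     (1 / real (card \<Gamma>)) *\<^sub>R ((columnvector (indicator_vec \<Gamma>) :: real ^ 1 ^ 'n) ** rowvector (indicator_vec \<Gamma>))"

definition partition_matrix :: "real ^ ('n::finite) ^ 'n \<Rightarrow> bool" where
  "partition_matrix X \<longleftrightarrow>
     (\<exists>\<Gamma>1 \<Gamma>2. \<Gamma>1 \<noteq> {} \<and> \<Gamma>2 \<noteq> {} \<and> \<Gamma>1 \<inter> \<Gamma>2 = {} \<and> \<Gamma>1 \<union> \<Gamma>2 = UNIV \<and>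
        X = cluster_matrix \<Gamma>1 + cluster_matrix \<Gamma>2)"

text \<open>
  With several optimal solutions, tightness means that one of them is a partition matrix, so its
  negation says that no optimal solution is a partition matrix.
\<close>

definition LP2_tight :: "(('n::{finite,linorder}) \<Rightarrow> real ^ 'm) \<Rightarrow> bool" where
  "LP2_tight y \<longleftrightarrow> (\<exists>X. LP2_optimal y X \<and> partition_matrix X)"

text \<open>The five points \<open>x\<^sup>1, \<dots>, x\<^sup>5\<close>; only the arguments \<open>1, \<dots>, 5\<close> are meaningful.\<close>

definition base_point :: "nat \<Rightarrow> real ^ 3" where
  "base_point p =
     (if p = 1 then vector [0, sqrt 3 / 3, 0]
      else if p = 2 then vector [1 / 2, - sqrt 3 / 6, 0]
      else if p = 3 then vector [- 1 / 2, - sqrt 3 / 6, 0]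
      else if p = 4 then vector [0, 0, 1 / 2]
      else vector [0, 0, - 1 / 2])"

text \<open>
  The type \<open>'m\<close> carries no order, so the coordinates of \<open>\<real>\<^sup>m\<close> are numbered by an enumeration
  \<open>e\<close> of \<open>'m\<close> by \<open>{1..m}\<close>; the first three coordinates are \<open>e 1\<close>, \<open>e 2\<close>, \<open>e 3\<close>.
\<close>

definition pad_zeros :: "(nat \<Rightarrow> 'm) \<Rightarrow> real ^ 3 \<Rightarrow> real ^ ('m::finite)" where
  "pad_zeros e x =
     (\<chi> c. if c = e 1 then x $ 1 else if c = e 2 then x $ 2 else if c = e 3 then x $ 3 else 0)"

text \<open>
  \<open>Y i\<close> is the random point with index \<open>i\<close>, drawn from the measure numbered \<open>src i\<close>, and \<open>n'\<close>
  points are drawn from each of the five measures.  Only the marginal laws of the points are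
  prescribed: their joint law is arbitrary, which includes independent draws.
\<close>

definition sampled_from ::
    "'w measure \<Rightarrow> (nat \<Rightarrow> (real ^ 'm) measure) \<Rightarrow> nat \<Rightarrow> (('n::finite) \<Rightarrow> nat) \<Rightarrow>
     ('n \<Rightarrow> 'w \<Rightarrow> real ^ ('m::finite)) \<Rightarrow> bool" where
  "sampled_from M \<mu> n' src Y \<longleftrightarrow>
     range src \<subseteq> {1..5} \<and>
     (\<forall>p\<in>{1..5}. card {i. src i = p} = n') \<and>
     (\<forall>i. Y i \<in> borel_measurable M \<and> distr M borel (Y i) = \<mu> (src i))"

end

theory Submission
  imports Defs
begin

text \<open>
  The five base points form a triangular bipyramid: the vertices \<open>1, 2, 3\<close> of an equilateral
  triangle of side \<open>1\<close> and two poles \<open>4, 5\<close>, also at distance \<open>1\<close>, while every triangle vertex is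
  at squared distance \<open>7/12\<close> from every pole.  The near pairs are thus exactly the pairs of a
  triangle vertex and a pole.  A fractional solution can spread its mass evenly over these pairs,
  whereas of two clusters one has at least three of the five base points and so contains a far pair.

  Suppose first that all points coincide with their base points.  A matrix whose entries depend
  only on the base points then has an objective value proportional to \<open>n'\<close>.  The weights of
  \<open>fractional_weight\<close> yield a feasible matrix of value \<open>27/14 n' < 1.93 n'\<close>.  A partition matrix
  has as its value twice the two-means cost of its partition, with the centroids as centres.  That
  cost does not increase if every point moves to the nearer of the two centres, and then copies of the
  same base point stay together, so that only the partitions of the five base points matter.
  The cheapest of these joins two triangle vertices with one pole and costs \<open>73/72\<close> per copy
  (\<open>two_means_bipyramid\<close>), so the value is at least \<open>73/36 n' > 2.02 n'\<close>.

  Points that move by at most \<open>r \<le> 3/1000\<close> do not close the gap between these values: by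
  \<open>\<parallel>u + v\<parallel>\<^sup>2 \<le> (1 + s) \<parallel>u\<parallel>\<^sup>2 + (1 + 1/s) \<parallel>v\<parallel>\<^sup>2\<close> with \<open>s = 1/100\<close>, the fractional solution still
  costs at most \<open>1.97 n'\<close> (\<open>fractional_solution_objective_le\<close>) and each partition matrix at least
  \<open>1.99 n'\<close> (\<open>partition_objective_ge\<close>).  So no partition matrix is optimal.  Probability enters only
  through the fact that, almost surely, all the finitely many points lie in their balls.
\<close>

section \<open>Spreads, centres and perturbations in inner product spaces\<close>

text \<open>
  This identity links sums over pairs, which are what the linear program sees, to distances from a
  centre.  It holds for every \<open>c\<close>: the centroid turns it into an equation for the cost of a cluster,
  and any other centre gives a lower bound for the sum of its squared distances.
\<close>

lemma sum_pairs_sq_norm: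
  fixes f :: "'i \<Rightarrow> 'a::real_inner"
  shows "(\<Sum>i\<in>A. \<Sum>j\<in>A. (norm (f i - f j))\<^sup>2)
    = 2 * real (card A) * (\<Sum>i\<in>A. (norm (f i - c))\<^sup>2) - 2 * (norm (\<Sum>i\<in>A. f i - c))\<^sup>2"
proof -
  define g where "g i = f i - c" for i
  have sq: "(norm (f i - f j))\<^sup>2 = (norm (g i))\<^sup>2 + (norm (g j))\<^sup>2 - 2 * (g i \<bullet> g j)" for i j
  proof -
    have "f i - f j = g i - g j" by (simp add: g_def)
    then show ?thesis
      by (simp add: power2_norm_eq_inner inner_diff_left inner_diff_right inner_commute)
  qed
  have "(\<Sum>i\<in>A. \<Sum>j\<in>A. g i \<bullet> g j) = (norm (\<Sum>i\<in>A. g i))\<^sup>2"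
    unfolding power2_norm_eq_inner inner_sum_left inner_sum_right by (rule sum.swap)
  then show ?thesis
    unfolding sq g_def[symmetric]
    by (simp add: sum.distrib sum_subtractf flip: sum_distrib_left)
qed

corollary sum_pairs_sq_norm_le:
  fixes f :: "'i \<Rightarrow> 'a::real_inner"
  shows "(\<Sum>i\<in>A. \<Sum>j\<in>A. (norm (f i - f j))\<^sup>2)
    \<le> 2 * real (card A) * (\<Sum>i\<in>A. (norm (f i - c))\<^sup>2)"
  unfolding sum_pairs_sq_norm[of f A c] by simp

corollary sum_pairs_sq_norm_centroid:
  fixes f :: "'i \<Rightarrow> 'a::real_inner"
  assumes "finite A" "A \<noteq> {}"
  obtains c where "(1 / real (card A)) * (\<Sum>i\<in>A. \<Sum>j\<in>A. (norm (f i - f j))\<^sup>2)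
    = 2 * (\<Sum>i\<in>A. (norm (f i - c))\<^sup>2)"
proof -
  define c where "c = (1 / real (card A)) *\<^sub>R (\<Sum>i\<in>A. f i)"
  have card: "card A \<noteq> 0"
    using assms by simp
  then have "(\<Sum>i\<in>A. f i - c) = 0"
    by (simp add: sum_subtractf sum_constant_scaleR c_def)
  with card show ?thesis
    by (intro that[of c]) (simp add: sum_pairs_sq_norm[of f A c])
qed

text \<open>
  Young's inequality.  Being linear in squared norms, it can be summed over all points with any
  weights, which makes it a convenient way to absorb the displacements of the points.
\<close>

lemma sq_norm_add_le:
  fixes u v :: "'a::real_inner"
  assumes "s > 0"
  shows "(norm (u + v))\<^sup>2 \<le> (1 + s) * (norm u)\<^sup>2 + (1 + 1 / s) * (norm v)\<^sup>2"
proof -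
  have "0 \<le> (norm (s *\<^sub>R u - v))\<^sup>2 / s"
    using assms by simp
  also have "\<dots> = s * (norm u)\<^sup>2 + (norm v)\<^sup>2 / s - 2 * (u \<bullet> v)"
    using assms unfolding power2_norm_eq_inner
    by (simp add: inner_diff_left inner_diff_right inner_commute field_simps power2_eq_square)
  finally show ?thesis
    by (simp add: power2_norm_eq_inner inner_add_left inner_add_right inner_commute algebra_simps)
qed

section \<open>The five base points\<close>

text \<open>
  The squared distances of the base points.  The argument uses the base points only through this
  table, so it applies to any five points with these distances in any inner product space.
\<close>

definition bipyramid_dist :: "nat \<Rightarrow> nat \<Rightarrow> real" where
  "bipyramid_dist p q = (if p = q then 0 else if (p \<le> 3) = (q \<le> 3) then 1 else 7 / 12)"

lemma atLeastAtMost_1_5: "{1..5::nat} = {1, 2, 3, 4, 5}"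
  by auto

lemma sq_norm_base_point_diff:
  assumes "p \<in> {1..5}" "q \<in> {1..5}"
  shows "(norm (base_point p - base_point q))\<^sup>2 = bipyramid_dist p q"
  using assms unfolding atLeastAtMost_1_5
  by (auto simp: base_point_def bipyramid_dist_def power2_norm_eq_inner inner_vec_def sum_3
      field_simps)

lemma norm_pad_zeros_diff:
  fixes e :: "nat \<Rightarrow> 'm::finite"
  assumes "inj_on e {1..m}" "3 \<le> m"
  shows "norm (pad_zeros e x - pad_zeros e y) = norm (x - y)"
proof -
  have e: "e 1 \<noteq> e 2" "e 1 \<noteq> e 3" "e 2 \<noteq> e 3"
    using assms by (auto dest!: inj_onD)
  have "(\<Sum>c\<in>UNIV. (pad_zeros e x $ c - pad_zeros e y $ c)\<^sup>2)
      = (\<Sum>c\<in>{e 1, e 2, e 3}. (pad_zeros e x $ c - pad_zeros e y $ c)\<^sup>2)"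
    by (intro sum.mono_neutral_right) (auto simp: pad_zeros_def)
  also have "\<dots> = (\<Sum>k\<in>UNIV. (x $ k - y $ k)\<^sup>2)"
    using e by (simp add: pad_zeros_def sum_3)
  finally show ?thesis
    by (simp add: norm_vec_def L2_set_def)
qed

text \<open>
  The distances only distinguish triangle vertices from poles, so the spread of a set of base points
  depends only on the numbers \<open>a\<close> and \<open>b\<close> of either kind.  This reduces the partitions of the
  five points to twelve cases.
\<close>

lemma sum_pairs_bipyramid_dist:
  assumes "finite S"
  defines "a \<equiv> real (card {p \<in> S. p \<le> 3})" and "b \<equiv> real (card {p \<in> S. \<not> p \<le> 3})"
  shows "(\<Sum>p\<in>S. \<Sum>q\<in>S. bipyramid_dist p q) = a\<^sup>2 + b\<^sup>2 + 7 / 6 * a * b - (a + b)"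
proof -
  have d: "bipyramid_dist p q = of_bool (p \<le> 3) * of_bool (q \<le> 3)
      + of_bool (\<not> p \<le> 3) * of_bool (\<not> q \<le> 3)
      + 7 / 12 * (of_bool (p \<le> 3) * of_bool (\<not> q \<le> 3))
      + 7 / 12 * (of_bool (\<not> p \<le> 3) * of_bool (q \<le> 3)) - of_bool (p = q)" for p q
    by (auto simp: bipyramid_dist_def)
  have ab: "(\<Sum>p\<in>S. of_bool (p \<le> 3)) = a" "(\<Sum>p\<in>S. of_bool (\<not> p \<le> 3)) = b"
    using assms(1) by (simp_all add: a_def b_def Int_def)
  have "(\<Sum>p\<in>S. \<Sum>q\<in>S. of_bool (p = q)) = (\<Sum>p\<in>S. of_bool (p \<le> 3) + of_bool (\<not> p \<le> 3) :: real)"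
    using assms(1) by (intro sum.cong) (auto simp: of_bool_def)
  also have "\<dots> = a + b"
    by (simp only: sum.distrib ab)
  finally have eq: "(\<Sum>p\<in>S. \<Sum>q\<in>S. of_bool (p = q)) = a + b" .
  show ?thesis
    unfolding d sum.distrib sum_subtractf sum_distrib_left[symmetric]
      sum_distrib_right[symmetric] ab eq
    by (simp add: power2_eq_square field_simps)
qed

text \<open>
  Each point chooses its nearer centre, which splits the five points into two sets \<open>S\<close> and \<open>T\<close>.
  The spread of each set bounds its distances to its centre from below.  The minimum over all
  splittings is attained by two triangle vertices and a pole against the rest, at
  \<open>(13/9 + 7/12) / 2 = 73/72\<close>.
\<close>

lemma two_means_bipyramid:
  fixes x :: "nat \<Rightarrow> 'a::real_inner"
  assumes dist: "\<And>p q. p \<in> {1..5} \<Longrightarrow> q \<in> {1..5} \<Longrightarrow> (norm (x p - x q))\<^sup>2 = bipyramid_dist p q"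
  shows "73 / 72 \<le> (\<Sum>p\<in>{1..5}. min ((norm (x p - c1))\<^sup>2) ((norm (x p - c2))\<^sup>2))"
proof -
  define S where "S = {p \<in> {1..5}. (norm (x p - c1))\<^sup>2 \<le> (norm (x p - c2))\<^sup>2}"
  define T where "T = {1..5} - S"
  define A where "A = (\<Sum>p\<in>S. (norm (x p - c1))\<^sup>2)"
  define B where "B = (\<Sum>p\<in>T. (norm (x p - c2))\<^sup>2)"
  have sub: "S \<subseteq> {1..5}" "T \<subseteq> {1..5}" by (auto simp: S_def T_def)
  then have fin: "finite S" "finite T" by (auto intro: finite_subset)
  have "(\<Sum>p\<in>{1..5}. min ((norm (x p - c1))\<^sup>2) ((norm (x p - c2))\<^sup>2))
      = (\<Sum>p\<in>T. min ((norm (x p - c1))\<^sup>2) ((norm (x p - c2))\<^sup>2))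
      + (\<Sum>p\<in>S. min ((norm (x p - c1))\<^sup>2) ((norm (x p - c2))\<^sup>2))"
    unfolding T_def using sub by (intro sum.subset_diff) auto
  also have "\<dots> = B + A"
    unfolding A_def B_def
    by (intro arg_cong2[where f = "(+)"] sum.cong) (auto simp: S_def T_def)
  finally have split: "(\<Sum>p\<in>{1..5}. min ((norm (x p - c1))\<^sup>2) ((norm (x p - c2))\<^sup>2)) = A + B"
    by simp
  define a where "a = card {p \<in> S. p \<le> 3}"
  define b where "b = card {p \<in> S. \<not> p \<le> 3}"
  define a' where "a' = card {p \<in> T. p \<le> 3}"
  define b' where "b' = card {p \<in> T. \<not> p \<le> 3}"
  have "a + a' = card ({p \<in> S. p \<le> 3} \<union> {p \<in> T. p \<le> 3})"
    unfolding a_def a'_def using fin by (subst card_Un_disjoint) (auto simp: T_def)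
  also have "{p \<in> S. p \<le> 3} \<union> {p \<in> T. p \<le> 3} = {1..3}"
    using sub by (auto simp: T_def)
  finally have a: "a + a' = 3" by simp
  have "b + b' = card ({p \<in> S. \<not> p \<le> 3} \<union> {p \<in> T. \<not> p \<le> 3})"
    unfolding b_def b'_def using fin by (subst card_Un_disjoint) (auto simp: T_def)
  also have "{p \<in> S. \<not> p \<le> 3} \<union> {p \<in> T. \<not> p \<le> 3} = {4..5}"
    using sub by (auto simp: T_def)
  finally have b: "b + b' = 2" by simp
  have card_split: "card R = card {p \<in> R. p \<le> 3} + card {p \<in> R. \<not> p \<le> 3}"
    if "finite R" for R :: "nat set"
    using that by (subst card_Un_disjoint[symmetric]) (auto intro!: arg_cong[where f = card])
  have pairs: "(\<Sum>p\<in>R. \<Sum>q\<in>R. bipyramid_dist p q)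
      \<le> 2 * real (card R) * (\<Sum>p\<in>R. (norm (x p - c))\<^sup>2)" if "R \<subseteq> {1..5}" for R c
  proof -
    have "(\<Sum>p\<in>R. \<Sum>q\<in>R. bipyramid_dist p q) = (\<Sum>p\<in>R. \<Sum>q\<in>R. (norm (x p - x q))\<^sup>2)"
      using that by (intro sum.cong refl) (auto simp: dist subset_iff)
    then show ?thesis
      using sum_pairs_sq_norm_le[of x R c] by simp
  qed
  have A: "real a ^ 2 + real b ^ 2 + 7 / 6 * real a * real b - (real a + real b)
      \<le> 2 * (real a + real b) * A"
    using pairs[OF sub(1), of c1] card_split[OF fin(1)]
    by (simp add: sum_pairs_bipyramid_dist[OF fin(1)] a_def b_def A_def)
  have B: "real a' ^ 2 + real b' ^ 2 + 7 / 6 * real a' * real b' - (real a' + real b')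
      \<le> 2 * (real a' + real b') * B"
    using pairs[OF sub(2), of c2] card_split[OF fin(2)]
    by (simp add: sum_pairs_bipyramid_dist[OF fin(2)] a'_def b'_def B_def)
  have pos: "0 \<le> A" "0 \<le> B" by (auto simp: A_def B_def sum_nonneg)
  have "a \<in> {0, 1, 2, 3}" "b \<in> {0, 1, 2}" using a b by auto
  moreover have "a' = 3 - a" "b' = 2 - b" using a b by auto
  ultimately have "73 / 72 \<le> A + B"
    using A B pos by (auto simp: power2_eq_square)
  then show ?thesis
    using split by simp
qed

section \<open>A cheap fractional solution\<close>

text \<open>
  Among the weights that respect the symmetries of the bipyramid, with \<open>\<alpha>\<close> on the diagonal of
  the triangle and \<open>f\<close> on the pairs of a triangle vertex and a pole, the trace and row sum conditions
  leave \<open>\<alpha>\<close> and \<open>f\<close> free and make the value equal to \<open>3 - 5 f\<close>.  The weight \<open>3/2 \<alpha> - 3 f\<close> between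
  the poles must not be negative, and the triangle inequality at a pole against two triangle
  vertices says \<open>f \<le> 1/2 - 2/3 \<alpha>\<close>.  Both are equalities at the best choice \<open>\<alpha> = 3/7\<close>,
  \<open>f = 3/14\<close>.
\<close>

definition fractional_weight :: "nat \<Rightarrow> nat \<Rightarrow> real" where
  "fractional_weight p q =
     (if (p \<le> 3) \<noteq> (q \<le> 3) then 3 / 14
      else if p \<le> 3 then (if p = q then 3 / 7 else 1 / 14)
      else (if p = q then 5 / 14 else 0))"

lemma sum_fractional_weight:
  assumes "p \<in> {1..5}"
  shows "(\<Sum>q\<in>{1..5}. fractional_weight p q) = 1"
  using assms unfolding atLeastAtMost_1_5 by (auto simp: fractional_weight_def)

lemma fractional_weight_value:
  "(\<Sum>p\<in>{1..5}. \<Sum>q\<in>{1..5}. bipyramid_dist p q * fractional_weight p q) = 27 / 14"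
  unfolding atLeastAtMost_1_5 by (simp add: fractional_weight_def bipyramid_dist_def)

lemma fractional_weight_nonneg: "0 \<le> fractional_weight p q"
  by (simp add: fractional_weight_def)

lemma fractional_weight_commute: "fractional_weight p q = fractional_weight q p"
  by (auto simp: fractional_weight_def)

text \<open>
  Different points may come from the same measure, so the inequality has to hold for coinciding
  arguments too; for \<open>q = s\<close> it says that no weight exceeds the mean of its two diagonal weights.
\<close>

lemma fractional_weight_triangle:
  "fractional_weight p q + fractional_weight p s \<le> fractional_weight p p + fractional_weight q s"
  by (auto simp: fractional_weight_def)

lemma sum_by_source:
  fixes g :: "nat \<Rightarrow> real" and src :: "'n::finite \<Rightarrow> nat"
  assumes "range src \<subseteq> {1..5}" "\<forall>p\<in>{1..5}. card {i. src i = p} = n'"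
  shows "(\<Sum>i\<in>UNIV. g (src i)) = real n' * (\<Sum>p\<in>{1..5}. g p)"
proof -
  have "(\<Sum>i\<in>UNIV. g (src i)) = (\<Sum>p\<in>{1..5}. \<Sum>i\<in>{i\<in>UNIV. src i = p}. g (src i))"
    using assms(1) by (intro sum.group[symmetric]) auto
  also have "\<dots> = (\<Sum>p\<in>{1..5}. real n' * g p)"
    using assms(2) by (intro sum.cong) auto
  finally show ?thesis by (simp add: sum_distrib_left)
qed

text \<open>
  Each of the \<open>n'\<close> copies of a base point receives an equal share, which keeps row sums and trace.
\<close>

definition fractional_solution :: "nat \<Rightarrow> ('n \<Rightarrow> nat) \<Rightarrow> real ^ ('n::finite) ^ 'n" where
  "fractional_solution n' src = (\<chi> i j. fractional_weight (src i) (src j) / real n')"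

lemma fractional_solution_feasible:
  fixes src :: "'n::{finite,linorder} \<Rightarrow> nat"
  assumes src: "range src \<subseteq> {1..5}" "\<forall>p\<in>{1..5}. card {i. src i = p} = n'" and n': "n' \<ge> 1"
  shows "LP2_feasible (fractional_solution n' src)"
proof -
  have "trace (fractional_solution n' src) = (\<Sum>p\<in>{1..5}. fractional_weight p p)"
    using n' sum_by_source[OF src, of "\<lambda>p. fractional_weight p p / real n'"]
    by (simp add: trace_def fractional_solution_def sum_distrib_left)
  also have "\<dots> = 2"
    unfolding atLeastAtMost_1_5 by (simp add: fractional_weight_def)
  finally have trace: "trace (fractional_solution n' src) = 2" .
  have row: "(\<Sum>j\<in>UNIV. fractional_weight (src i) (src j) / real n') = 1" for i
  proof -
    have "src i \<in> {1..5}" using src(1) by blast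
    from sum_fractional_weight[OF this] show ?thesis
      using n' sum_by_source[OF src, of "\<lambda>p. fractional_weight (src i) p / real n'"]
      by (simp add: sum_divide_distrib[symmetric])
  qed
  have "fractional_weight p q / real n' + fractional_weight p s / real n'
      \<le> fractional_weight p p / real n' + fractional_weight q s / real n'" for p q s
    unfolding add_divide_distrib[symmetric]
    by (intro divide_right_mono fractional_weight_triangle) simp
  then show ?thesis
    using row trace
    by (auto simp: LP2_feasible_def fractional_solution_def transpose_def vec_eq_iff
        fractional_weight_commute fractional_weight_nonneg)
qed

lemma fractional_solution_objective_le:
  fixes src :: "'n::finite \<Rightarrow> nat" and x :: "nat \<Rightarrow> real ^ 'm"
  assumes src: "range src \<subseteq> {1..5}" "\<forall>p\<in>{1..5}. card {i. src i = p} = n'" and n': "n' \<ge> 1"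
    and dist: "\<And>p q. p \<in> {1..5} \<Longrightarrow> q \<in> {1..5} \<Longrightarrow> (norm (x p - x q))\<^sup>2 = bipyramid_dist p q"
    and near: "\<And>i. norm (y i - x (src i)) \<le> 3 / 1000"
  shows "LP2_objective y (fractional_solution n' src) \<le> 197 / 100 * real n'"
proof -
  \<comment> \<open>A difference of two points moves by at most \<open>6/1000\<close>; the second summand is \<open>(1 + 1/s)\<close> times
    its square for \<open>s = 1/100\<close>.\<close>
  define U where "U p q = 101 / 100 * bipyramid_dist p q + 101 * (36 / 1000000)" for p q
  have U: "sq_dist y i j \<le> U (src i) (src j)" for i j
  proof -
    have "norm ((y i - x (src i)) - (y j - x (src j))) \<le> 6 / 1000"
      using norm_triangle_ineq4[of "y i - x (src i)" "y j - x (src j)"] near[of i] near[of j]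
      by linarith
    then have "(norm ((y i - x (src i)) - (y j - x (src j))))\<^sup>2 \<le> (6 / 1000)\<^sup>2"
      by (intro power_mono) auto
    moreover have "(norm (x (src i) - x (src j)))\<^sup>2 = bipyramid_dist (src i) (src j)"
      using src(1) by (intro dist) blast+
    ultimately show ?thesis
      using sq_norm_add_le[of "1 / 100" "x (src i) - x (src j)"
          "(y i - x (src i)) - (y j - x (src j))"]
      by (simp add: U_def sq_dist_def algebra_simps power2_eq_square)
  qed
  have "LP2_objective y (fractional_solution n' src)
      \<le> (\<Sum>i\<in>UNIV. \<Sum>j\<in>UNIV. U (src i) (src j) * (fractional_weight (src i) (src j) / real n'))"
    unfolding LP2_objective_def fractional_solution_def vec_lambda_beta
    by (intro sum_mono mult_right_mono U divide_nonneg_nonneg fractional_weight_nonneg of_nat_0_le_iff)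
  also have "\<dots> = (\<Sum>i\<in>UNIV. \<Sum>q\<in>{1..5}. U (src i) q * fractional_weight (src i) q)"
  proof (intro sum.cong refl)
    fix i
    show "(\<Sum>j\<in>UNIV. U (src i) (src j) * (fractional_weight (src i) (src j) / real n'))
        = (\<Sum>q\<in>{1..5}. U (src i) q * fractional_weight (src i) q)"
      using n' sum_by_source[OF src, of "\<lambda>q. U (src i) q * (fractional_weight (src i) q / real n')"]
      by (simp add: sum_divide_distrib[symmetric])
  qed
  also have "\<dots> = real n' * (\<Sum>p\<in>{1..5}. \<Sum>q\<in>{1..5}. U p q * fractional_weight p q)"
    by (rule sum_by_source[OF src])
  also have "(\<Sum>p\<in>{1..5}. \<Sum>q\<in>{1..5}. U p q * fractional_weight p q)
      = 101 / 100 * (\<Sum>p\<in>{1..5}. \<Sum>q\<in>{1..5}. bipyramid_dist p q * fractional_weight p q)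
      + 101 * (36 / 1000000) * (\<Sum>p\<in>{1..5}. \<Sum>q\<in>{1..5}. fractional_weight p q)"
    by (simp add: U_def distrib_right sum.distrib sum_distrib_left mult.assoc)
  \<comment> \<open>The weights sum to the number \<open>5\<close> of rows.\<close>
  also have "\<dots> = 101 / 100 * (27 / 14) + 101 * (36 / 1000000) * 5"
    by (simp only: fractional_weight_value sum_fractional_weight cong: sum.cong) simp
  also have "real n' * \<dots> \<le> real n' * (197 / 100)"
    by (intro mult_left_mono) auto
  finally show ?thesis
    by (simp add: mult.commute)
qed

section \<open>Every partition matrix is expensive\<close>

lemma objective_add: "LP2_objective y (X + Z) = LP2_objective y X + LP2_objective y Z"
  by (simp add: LP2_objective_def distrib_left sum.distrib)

lemma objective_cluster_matrix:
  "LP2_objective y (cluster_matrix \<Gamma>)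
    = (1 / real (card \<Gamma>)) * (\<Sum>i\<in>\<Gamma>. \<Sum>j\<in>\<Gamma>. (norm (y i - y j))\<^sup>2)"
proof -
  have entry: "cluster_matrix \<Gamma> $ i $ j
      = (1 / real (card \<Gamma>)) * (indicator \<Gamma> i * indicator \<Gamma> j)" for i j
    by (simp add: cluster_matrix_def indicator_vec_def columnvector_def rowvector_def
        matrix_matrix_mult_def)
  have "LP2_objective y (cluster_matrix \<Gamma>) = (1 / real (card \<Gamma>)) *
      (\<Sum>i\<in>UNIV. indicator \<Gamma> i * (\<Sum>j\<in>UNIV. indicator \<Gamma> j * sq_dist y i j))"
    unfolding LP2_objective_def entry sum_distrib_left by (simp add: mult_ac)
  also have "\<dots> = (1 / real (card \<Gamma>)) * (\<Sum>i\<in>\<Gamma>. \<Sum>j\<in>\<Gamma>. sq_dist y i j)"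
    by (simp add: indicator_def sum.If_cases if_distrib[where f = "\<lambda>t. t * _"] cong: if_cong)
  finally show ?thesis
    by (simp add: sq_dist_def)
qed

text \<open>
  Each point pays at least its squared distance to the nearer of the two centroids.  This bound
  forgets the partition, and up to the displacement it depends only on the base point, so it
  reduces to the two-means problem for five points even if the partition separates copies of the
  same base point.
\<close>

lemma partition_objective_ge:
  fixes src :: "'n::finite \<Rightarrow> nat" and x :: "nat \<Rightarrow> real ^ 'm"
  assumes src: "range src \<subseteq> {1..5}" "\<forall>p\<in>{1..5}. card {i. src i = p} = n'"
    and dist: "\<And>p q. p \<in> {1..5} \<Longrightarrow> q \<in> {1..5} \<Longrightarrow> (norm (x p - x q))\<^sup>2 = bipyramid_dist p q"
    and near: "\<And>i. norm (y i - x (src i)) \<le> 3 / 1000"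
    and X: "partition_matrix X"
  shows "199 / 100 * real n' \<le> LP2_objective y X"
proof -
  obtain \<Gamma>1 \<Gamma>2 where \<Gamma>: "\<Gamma>1 \<noteq> {}" "\<Gamma>2 \<noteq> {}" "\<Gamma>1 \<inter> \<Gamma>2 = {}" "\<Gamma>1 \<union> \<Gamma>2 = UNIV"
    and X_eq: "X = cluster_matrix \<Gamma>1 + cluster_matrix \<Gamma>2"
    using X unfolding partition_matrix_def by blast
  obtain c1 where c1: "LP2_objective y (cluster_matrix \<Gamma>1) = 2 * (\<Sum>i\<in>\<Gamma>1. (norm (y i - c1))\<^sup>2)"
    unfolding objective_cluster_matrix by (rule sum_pairs_sq_norm_centroid[of \<Gamma>1 y]) (use \<Gamma> in auto)
  obtain c2 where c2: "LP2_objective y (cluster_matrix \<Gamma>2) = 2 * (\<Sum>i\<in>\<Gamma>2. (norm (y i - c2))\<^sup>2)"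
    unfolding objective_cluster_matrix by (rule sum_pairs_sq_norm_centroid[of \<Gamma>2 y]) (use \<Gamma> in auto)
  define M where "M p = min ((norm (x p - c1))\<^sup>2) ((norm (x p - c2))\<^sup>2)" for p
  \<comment> \<open>Young's inequality for \<open>x = y + (x - y)\<close> with \<open>s = 1/100\<close>, solved for the distance from \<open>y\<close>;
    the error is \<open>101 r\<^sup>2 / 1.01 = 100 r\<^sup>2\<close>, at most \<open>9/10000\<close>.\<close>
  define L where "L p = 100 / 101 * M p - 9 / 10000" for p
  have near': "100 / 101 * (norm (x (src i) - c))\<^sup>2 - 9 / 10000 \<le> (norm (y i - c))\<^sup>2" for i c
  proof -
    have "(norm (x (src i) - y i))\<^sup>2 \<le> (3 / 1000)\<^sup>2"
      using near[of i] by (intro power_mono) (auto simp: norm_minus_commute)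
    then show ?thesis
      using sq_norm_add_le[of "1 / 100" "y i - c" "x (src i) - y i"]
      by (simp add: power2_eq_square)
  qed
  have L: "L (src i) \<le> (norm (y i - c))\<^sup>2" if "c = c1 \<or> c = c2" for i c
    using that near'[of i c] by (auto simp: L_def M_def)
  have "199 / 100 * real n' \<le> 2 * (real n' * (100 / 101 * (73 / 72) - 5 * (9 / 10000)))"
    by simp
  also have "\<dots> \<le> 2 * (real n' * (100 / 101 * (\<Sum>p\<in>{1..5}. M p) - 5 * (9 / 10000)))"
    unfolding M_def
    by (intro mult_left_mono diff_right_mono two_means_bipyramid dist) auto
  also have "\<dots> = 2 * (\<Sum>i\<in>UNIV. L (src i))"
    unfolding sum_by_source[OF src] by (simp add: L_def sum_subtractf sum_distrib_left)
  also have "\<dots> = 2 * ((\<Sum>i\<in>\<Gamma>1. L (src i)) + (\<Sum>i\<in>\<Gamma>2. L (src i)))"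
    unfolding \<Gamma>(4)[symmetric] using \<Gamma>(3) by (subst sum.union_disjoint) auto
  also have "\<dots> \<le> 2 * ((\<Sum>i\<in>\<Gamma>1. (norm (y i - c1))\<^sup>2) + (\<Sum>i\<in>\<Gamma>2. (norm (y i - c2))\<^sup>2))"
    by (intro mult_left_mono add_mono sum_mono L) auto
  also have "\<dots> = LP2_objective y X"
    by (simp add: X_eq objective_add c1 c2)
  finally show ?thesis .
qed

section \<open>Non-tightness\<close>

theorem not_tight_near_bipyramid:
  fixes src :: "'n::{finite,linorder} \<Rightarrow> nat" and x :: "nat \<Rightarrow> real ^ 'm"
  assumes src: "range src \<subseteq> {1..5}" "\<forall>p\<in>{1..5}. card {i. src i = p} = n'" and n': "n' \<ge> 1"
    and dist: "\<And>p q. p \<in> {1..5} \<Longrightarrow> q \<in> {1..5} \<Longrightarrow> (norm (x p - x q))\<^sup>2 = bipyramid_dist p q"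
    and near: "\<And>i. norm (y i - x (src i)) \<le> 3 / 1000"
  shows "\<not> LP2_tight y"
proof
  assume "LP2_tight y"
  then obtain X where X: "LP2_optimal y X" "partition_matrix X"
    unfolding LP2_tight_def by blast
  have "199 / 100 * real n' \<le> LP2_objective y X"
    by (rule partition_objective_ge[OF src dist near X(2)])
  also have "\<dots> \<le> LP2_objective y (fractional_solution n' src)"
    using X(1) fractional_solution_feasible[OF src n'] by (simp add: LP2_optimal_def)
  also have "\<dots> \<le> 197 / 100 * real n'"
    by (rule fractional_solution_objective_le[OF src n' dist near])
  finally show False
    using n' by simp
qed

theorem corollary1:
  fixes r :: real and m n' :: nat
    and e :: "nat \<Rightarrow> 'm::finite"
    and \<mu> :: "nat \<Rightarrow> (real ^ 'm) measure"
    and M :: "'w measure"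
    and src :: "'n::{finite,linorder} \<Rightarrow> nat"
    and Y :: "'n \<Rightarrow> 'w \<Rightarrow> real ^ 'm"
  assumes "0 \<le> r" and "r \<le> 3 * 10 powi (-3)"
    and "3 \<le> m" and "bij_betw e {1..m} (UNIV :: 'm set)"
    and "\<And>p. p \<in> {1..5} \<Longrightarrow> prob_space (\<mu> p) \<and> sets (\<mu> p) = sets borel"
    and "\<And>p. p \<in> {1..5} \<Longrightarrow> emeasure (\<mu> p) (- cball (pad_zeros e (base_point p)) r) = 0"
    and "1 \<le> n'"
    and "prob_space M"
    and "sampled_from M \<mu> n' src Y"
  shows "AE \<omega> in M. \<not> LP2_tight (\<lambda>i. Y i \<omega>)"
proof -
  let ?x = "\<lambda>p. pad_zeros e (base_point p) :: real ^ 'm"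
  have src: "range src \<subseteq> {1..5}" "\<forall>p\<in>{1..5}. card {i. src i = p} = n'"
    and Y: "Y i \<in> borel_measurable M" "distr M borel (Y i) = \<mu> (src i)" for i
    using assms(9) by (auto simp: sampled_from_def)
  have r: "r \<le> 3 / 1000"
    using assms(2) by (simp add: power_int_def power3_eq_cube field_simps)
  have dist: "(norm (?x p - ?x q))\<^sup>2 = bipyramid_dist p q" if "p \<in> {1..5}" "q \<in> {1..5}" for p q
    using norm_pad_zeros_diff[of e m] assms(3,4) sq_norm_base_point_diff[OF that]
    by (simp add: bij_betw_def)
  have "AE \<omega> in M. Y i \<omega> \<in> cball (?x (src i)) r" for i
  proof (rule AE_I')
    let ?N = "Y i -` (- cball (?x (src i)) r) \<inter> space M"
    have "emeasure M ?N = emeasure (distr M borel (Y i)) (- cball (?x (src i)) r)"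
      using Y(1) by (intro emeasure_distr[symmetric]) auto
    also have "\<dots> = 0"
      unfolding Y(2) using src(1) by (intro assms(6)) blast
    finally show "?N \<in> null_sets M"
      using measurable_sets[OF Y(1), of "- cball (?x (src i)) r" i] by auto
    show "{\<omega> \<in> space M. \<not> Y i \<omega> \<in> cball (?x (src i)) r} \<subseteq> ?N"
      by auto
  qed
  then have "AE \<omega> in M. \<forall>i. Y i \<omega> \<in> cball (?x (src i)) r"
    by (intro AE_all_countable[THEN iffD2]) blast
  then show ?thesis
  proof (rule AE_mp, intro AE_I2 impI)
    fix \<omega> assume "\<forall>i. Y i \<omega> \<in> cball (?x (src i)) r"
    then have "norm (Y i \<omega> - ?x (src i)) \<le> 3 / 1000" for i
      using r by (metis dist_commute dist_norm mem_cball order_trans)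
    then show "\<not> LP2_tight (\<lambda>i. Y i \<omega>)"
      by (intro not_tight_near_bipyramid[OF src assms(7) dist])
  qed
qed

end
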